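(* For any distinct prime numbers $p_1,p_2,p_3$ and natural numbers $n_1,n_2,n_3\ge 1$, put $N=p_1^{n_1}p_2^{n_2}p_3^{n_3}$. Then $$Cl_2(\mathbb{Z}_N)\cong Shu^{|U'(\mathbb{Z}_N)|}_{|U(\mathbb{Z}_N)|}(G_1),$$ where $G_1$ is the simple graph with vertex set $\{a,b,c,d,e,f\}$ and edge set $\{ab,\,bc,\,ac,\,ad,\,be,\,cf\}$.
   Context: $\mathbb{Z}_N$ is the ring of integers modulo $N$. For a ring $R$ with identity, $Id(R)$ is the set of idempotents, $U(R)$ the set of units, and $U'(R)=\{u\in U(R):u^2=1\}$. $Cl_2(R)$ is the simple undirected graph with vertex set $\{(e,u): e\in Id(R)\setminus\{0\},\ u\in U(R)\}$, in which two distinct vertices $(e,u)$ and $(f,v)$ are adjacent if and only if $ef=fe=0$ or $uv=vu=1$. The $(t,n)$-shuriken graph: let $G$ be a simple graph and let $n,t$ be positive integers with $n-t$ even ($t\le n$ in all uses here). Add a new vertex $z\notin V(G)$ to $G$ and take $n$ copies of the resulting graph; $G'_i$ is the $i$-th copy, with vertex set $V(G'_i)=\{z_i\}\cup\{v_i: v\in V(G)\}$. Then $Shu^t_n(G)$ is the simple graph with vertex set $\bigcup_{i=1}^n V(G'_i)$ and edge set $$\{u_iv_j: uv\in E(G),\ i,j\in\{1,\dots,n\}\}\cup\{u_iv_i: u_i,v_i\in V(G'_i),\ u_i\ne v_i,\ i\in\{1,\dots,t\}\}\cup\left\{u_iv_{n+t+1-i}: u_i\in V(G'_i),\ v_{n+t+1-i}\in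 V(G'_{n+t+1-i}),\ i\in\{t+1,\dots,\tfrac{n+t}{2}\}\right\},$$ where in the last two sets $u$ and $v$ range over $V(G)\cup\{z\}$ (with $u=v$ allowed in the last set). *)

theory Defs
  imports "HOL-Number_Theory.Residues" "Graph_Theory.Graph_Theory"
begin

text \<open>
  A simple undirected graph is represented as a symmetric, loop-free
  \<^typ>\<open>'a pair_pre_digraph\<close>: an edge \<open>uv\<close> is the pair of arcs \<open>(u, v)\<close>, \<open>(v, u)\<close>.
  For such graphs \<^const>\<open>digraph_iso\<close> (applied through \<^const>\<open>with_proj\<close>) is the usual
  isomorphism of simple graphs.
\<close>

definition idempotents :: "('a, 'b) ring_scheme \<Rightarrow> 'a set" where
  "idempotents R = {e \<in> carrier R. e \<otimes>\<^bsub>R\<^esub> e = e}"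

definition involutory_units :: "('a, 'b) ring_scheme \<Rightarrow> 'a set" where
  "involutory_units R = {u \<in> Units R. u [^]\<^bsub>R\<^esub> (2::nat) = \<one>\<^bsub>R\<^esub>}"

definition Cl2_verts :: "('a, 'b) ring_scheme \<Rightarrow> ('a \<times> 'a) set" where
  "Cl2_verts R = (idempotents R - {\<zero>\<^bsub>R\<^esub>}) \<times> Units R"

definition Cl2 :: "('a, 'b) ring_scheme \<Rightarrow> ('a \<times> 'a) pair_pre_digraph" where
  "Cl2 R = \<lparr> pverts = Cl2_verts R,
     parcs = {((e, u), (f, v)) | e u f v.
       (e, u) \<in> Cl2_verts R \<and> (f, v) \<in> Cl2_verts R \<and> (e, u) \<noteq> (f, v) \<and>
       (e \<otimes>\<^bsub>R\<^esub> f = \<zero>\<^bsub>R\<^esub> \<and> f \<otimes>\<^bsub>R\<^esub> e = \<zero>\<^bsub>R\<^esub> \<or>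
        u \<otimes>\<^bsub>R\<^esub> v = \<one>\<^bsub>R\<^esub> \<and> v \<otimes>\<^bsub>R\<^esub> u = \<one>\<^bsub>R\<^esub>)} \<rparr>"

text \<open>
  The vertex \<open>z \<notin> V(G)\<close> is \<^const>\<open>None\<close>, a vertex \<open>v\<close> of \<open>G\<close> is \<open>Some v\<close>, and the
  \<open>i\<close>-th copy \<open>x\<^sub>i\<close> of \<open>x\<close> is \<open>(x, i)\<close>.
\<close>

definition shuriken_base :: "'a pair_pre_digraph \<Rightarrow> 'a option set" where
  "shuriken_base G = insert None (Some ` pverts G)"

text \<open>
  \<open>shuriken t n G\<close> is only meaningful for \<open>1 \<le> t \<le> n\<close> with \<open>n - t\<close> even; then \<open>div\<close> and
  \<open>-\<close> below are exact.
\<close>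

definition shuriken :: "nat \<Rightarrow> nat \<Rightarrow> 'a pair_pre_digraph \<Rightarrow> ('a option \<times> nat) pair_pre_digraph" where
  "shuriken t n G = \<lparr> pverts = shuriken_base G \<times> {1..n},
     parcs = symcl (
       {((Some u, i), (Some v, j)) | u v i j. (u, v) \<in> parcs G \<and> i \<in> {1..n} \<and> j \<in> {1..n}} \<union>
       {((x, i), (y, i)) | x y i.
          x \<in> shuriken_base G \<and> y \<in> shuriken_base G \<and> x \<noteq> y \<and> i \<in> {1..t}} \<union>
       {((x, i), (y, n + t + 1 - i)) | x y i.
          x \<in> shuriken_base G \<and> y \<in> shuriken_base G \<and> i \<in> {t + 1..(n + t) div 2}}) \<rparr>"

datatype G1_vertex = va | vb | vc | vd | ve | vf

definition G1 :: "G1_vertex pair_pre_digraph" where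
  "G1 = \<lparr> pverts = {va, vb, vc, vd, ve, vf},
     parcs = symcl {(va, vb), (vb, vc), (va, vc), (va, vd), (vb, ve), (vc, vf)} \<rparr>"

lemma pair_bidirected_Cl2: "pair_bidirected_digraph (Cl2 R)"
  by unfold_locales (auto simp: Cl2_def symmetric_def sym_def)

lemma sym_symcl: "sym (symcl A)"
  by (auto simp: symcl_def sym_def)

lemma pair_bidirected_shuriken:
  assumes "pair_bidirected_digraph G" and "t \<le> n"
  shows "pair_bidirected_digraph (shuriken t n G)"
proof -
  interpret G: pair_bidirected_digraph G by fact
  have *: "u \<in> pverts G" "v \<in> pverts G" "u \<noteq> v" if "(u, v) \<in> parcs G" for u v
    using that G.pair_no_loops G.in_arcsD1 G.in_arcsD2 by force+
  show ?thesis
  proof unfold_locales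
    show "symmetric (with_proj (shuriken t n G))"
      by (simp add: symmetric_def shuriken_def sym_symcl)
  qed (use assms(2) in \<open>auto simp: shuriken_def shuriken_base_def symcl_def dest: *\<close>)
qed

lemma pair_bidirected_G1: "pair_bidirected_digraph G1"
  by unfold_locales (auto simp: G1_def symmetric_def sym_symcl, auto simp: symcl_def)

end

theory Submission
  imports Defs
begin

text \<open>
  Adjacency in the clean graph of a ring is a disjunction of a condition on the idempotents of the
  two vertices and a condition on their units, and each condition has its counterpart in a
  shuriken graph: the idempotents supply the vertices of a copy, the units the indices of the
  copies.

  The condition on the units, \<open>uv = vu = 1\<close>, says that \<open>v\<close> is the image of \<open>u\<close> under the involution
  \<open>u \<mapsto> u\<^sup>-\<^sup>1\<close>, whose fixed points are the involutory units. In \<open>shuriken t n G\<close>, the copies \<open>i\<close> and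
  \<open>j\<close> are completely joined, apart from loops, when \<open>j\<close> is the image of \<open>i\<close> under the involution
  that fixes \<open>1, \<dots>, t\<close> and reverses \<open>t + 1, \<dots>, n\<close> (called \<open>mirror\<close> below). If \<open>n - t\<close> is even, the
  reversed block has no further fixed point. Two involutions of \<open>n\<close>-element sets with \<open>t\<close> fixed
  points each are conjugate (\<open>involution_enumeration\<close>), so the units can be numbered in such a way
  that inversion becomes \<open>mirror\<close>. Hence for any ring with finitely many units the isomorphism
  reduces to a matching of the nonzero idempotents with \<open>V(G) \<union> {z}\<close> under which orthogonality
  becomes adjacency in \<open>G\<close> (\<open>Cl2_iso_shuriken\<close>).

  For \<open>\<int>\<^sub>N\<close> the Chinese remainder theorem gives this matching. Modulo a power of a prime the only
  idempotents are \<open>0\<close> and \<open>1\<close>, so an idempotent modulo \<open>N\<close> is determined by the set of prime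
  divisors of \<open>N\<close> modulo which it is \<open>1\<close>, all sets of prime divisors occur, and two idempotents are
  orthogonal if and only if their sets are disjoint. With three primes the nonempty sets are the
  whole set, which meets every other one and takes the role of \<open>z\<close>, the three singletons, which
  form the triangle of \<open>G1\<close>, and the three pairs, each disjoint only from the complementary
  singleton; these are the pendant vertices.
\<close>

section \<open>Numbering a finite set with an involution\<close>

definition mirror :: "nat \<Rightarrow> nat \<Rightarrow> nat \<Rightarrow> nat" where
  "mirror t n i = (if i \<le> t then i else n + t + 1 - i)"

text \<open>
  Conjugacy of involutions with equally many points and fixed points. The points that are not fixed
  split into two halves exchanged by \<open>\<sigma>\<close>: an injection \<open>f\<close> into the natural numbers picks the
  smaller point of every orbit. Fixed points are numbered first, then one half in any order; the
  numbers of the other half are then forced.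
\<close>

lemma involution_enumeration:
  assumes fin: "finite A"
    and \<sigma>A: "\<And>x. x \<in> A \<Longrightarrow> \<sigma> x \<in> A"
    and \<sigma>\<sigma>: "\<And>x. x \<in> A \<Longrightarrow> \<sigma> (\<sigma> x) = x"
    and t: "t = card {x \<in> A. \<sigma> x = x}" and n: "n = card A"
  obtains \<phi> where "bij_betw \<phi> A {1..n}" "\<And>x. x \<in> A \<Longrightarrow> \<phi> (\<sigma> x) = mirror t n (\<phi> x)"
    and "t \<le> n" "even (n - t)"
proof -
  obtain f :: "_ \<Rightarrow> nat" where f: "inj_on f A"
    using finite_imp_inj_to_nat_seg[OF fin] by blast
  define F H H' where "F = {x \<in> A. \<sigma> x = x}" and "H = {x \<in> A. f x < f (\<sigma> x)}"
    and "H' = {x \<in> A. f (\<sigma> x) < f x}"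
  have fin': "finite F" "finite H" "finite H'"
    using fin by (auto simp: F_def H_def H'_def)
  have f_eq: "f x = f (\<sigma> x) \<longleftrightarrow> \<sigma> x = x" if "x \<in> A" for x
    using f that \<sigma>A[OF that] by (auto dest: inj_onD)
  have A: "A = F \<union> (H \<union> H')"
    using f_eq by (force simp: F_def H_def H'_def)
  have disj: "F \<inter> (H \<union> H') = {}" "H \<inter> H' = {}"
    by (auto simp: F_def H_def H'_def)
  have \<sigma>_H': "bij_betw \<sigma> H' H"
    by (rule bij_betwI[where g = \<sigma>]) (auto simp: H_def H'_def \<sigma>A \<sigma>\<sigma>)
  define h where "h = card H"
  have nth: "n = t + 2 * h"
  proof -
    have "n = card F + (card H + card H')"
      unfolding n by (subst A) (use fin' disj in \<open>simp add: card_Un_disjoint\<close>)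
    then show ?thesis
      using bij_betw_same_card[OF \<sigma>_H'] t by (simp add: h_def flip: F_def)
  qed
  have "card F = card {1..t}" "card H = card {t + 1..t + h}"
    by (simp_all add: t F_def h_def)
  then obtain a b where a: "bij_betw a F {1..t}" and b: "bij_betw b H {t + 1..t + h}"
    using finite_same_card_bij fin' by (metis finite_atLeastAtMost)
  define \<phi> where "\<phi> x = (if x \<in> F then a x else if x \<in> H then b x else n + t + 1 - b (\<sigma> x))" for x
  have "bij_betw \<phi> F {1..t}"
    using a by (subst bij_betw_cong[of _ _ a]) (auto simp: \<phi>_def)
  moreover have "bij_betw \<phi> H {t + 1..t + h}"
    using b disj by (subst bij_betw_cong[of _ _ b]) (auto simp: \<phi>_def)
  moreover have "bij_betw \<phi> H' {t + h + 1..n}"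
  proof -
    have "bij_betw (\<lambda>i. n + t + 1 - i) {t + 1..t + h} {t + h + 1..n}"
      by (rule bij_betwI[where g = "\<lambda>i. n + t + 1 - i"]) (auto simp: nth)
    from bij_betw_trans[OF bij_betw_trans[OF \<sigma>_H' b] this] show ?thesis
      using disj by (subst bij_betw_cong[of _ _ "(\<lambda>i. n + t + 1 - i) \<circ> (b \<circ> \<sigma>)"]) (auto simp: \<phi>_def)
  qed
  ultimately have "bij_betw \<phi> (F \<union> (H \<union> H')) ({1..t} \<union> ({t + 1..t + h} \<union> {t + h + 1..n}))"
    by (intro bij_betw_combine) (auto simp: nth)
  also have "{1..t} \<union> ({t + 1..t + h} \<union> {t + h + 1..n}) = {1..n}"
    by (auto simp: nth)
  finally have \<phi>: "bij_betw \<phi> A {1..n}"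
    using A by simp
  have "\<phi> (\<sigma> x) = mirror t n (\<phi> x)" if x: "x \<in> A" for x
  proof -
    consider "x \<in> F" | "x \<in> H" | "x \<in> H'"
      using x A by blast
    then show ?thesis
    proof cases
      case 1
      then have "a x \<le> t" and "\<sigma> x = x"
        using bij_betwE[OF a] by (auto simp: F_def)
      with 1 show ?thesis
        by (simp add: \<phi>_def mirror_def)
    next
      case 2
      then have "\<sigma> x \<in> H'"
        by (simp add: H_def H'_def \<sigma>A \<sigma>\<sigma>)
      moreover have "t + 1 \<le> b x" "b x \<le> t + h"
        using bij_betwE[OF b] 2 by auto
      moreover have "x \<notin> F" "\<sigma> x \<notin> F" "\<sigma> x \<notin> H"
        using disj 2 \<open>\<sigma> x \<in> H'\<close> by blast+
      ultimately show ?thesis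
        using 2 x by (simp add: \<phi>_def mirror_def \<sigma>\<sigma>)
    next
      case 3
      then have "\<sigma> x \<in> H"
        using \<sigma>_H' bij_betwE by blast
      moreover have "t + 1 \<le> b (\<sigma> x)" "b (\<sigma> x) \<le> t + h"
        using bij_betwE[OF b] \<open>\<sigma> x \<in> H\<close> by auto
      moreover have "x \<notin> F" "x \<notin> H" "\<sigma> x \<notin> F"
        using disj 3 \<open>\<sigma> x \<in> H\<close> by blast+
      ultimately show ?thesis
        using 3 x by (simp add: \<phi>_def mirror_def nth)
    qed
  qed
  with \<phi> nth show ?thesis
    using that by simp
qed

section \<open>Isomorphisms onto shuriken graphs\<close>

lemma digraph_iso_with_projI:
  assumes "pair_wf_digraph G" and "pair_wf_digraph H"
    and \<phi>: "bij_betw \<phi> (pverts G) (pverts H)"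
    and arcs: "\<And>u v. \<lbrakk>u \<in> pverts G; v \<in> pverts G\<rbrakk> \<Longrightarrow> (u, v) \<in> parcs G \<longleftrightarrow> (\<phi> u, \<phi> v) \<in> parcs H"
  shows "digraph_iso (with_proj G) (with_proj H)"
proof -
  interpret G: pair_wf_digraph G by fact
  interpret H: pair_wf_digraph H by fact
  define h where "h = \<lparr>iso_verts = \<phi>, iso_arcs = map_prod \<phi> \<phi>, iso_head = snd, iso_tail = fst\<rparr>"
  have "inj_on (map_prod \<phi> \<phi>) (pverts G \<times> pverts G)"
    using bij_betw_imp_inj_on[OF \<phi>] by (intro map_prod_inj_on)
  then have "inj_on (map_prod \<phi> \<phi>) (parcs G)"
    by (rule inj_on_subset) (auto dest: G.in_arcsD1 G.in_arcsD2)
  then have "pre_digraph.digraph_isomorphism (with_proj G) h"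
    using bij_betw_imp_inj_on[OF \<phi>] G.wf_digraph_axioms
    by (simp add: pre_digraph.digraph_isomorphism_def h_def)
  moreover have "map_prod \<phi> \<phi> ` parcs G = parcs H"
  proof (intro equalityI subrelI)
    fix x y assume "(x, y) \<in> map_prod \<phi> \<phi> ` parcs G"
    then show "(x, y) \<in> parcs H"
      using arcs by (auto dest: G.in_arcsD1 G.in_arcsD2)
  next
    fix x y assume xy: "(x, y) \<in> parcs H"
    then have "x \<in> \<phi> ` pverts G" "y \<in> \<phi> ` pverts G"
      using bij_betw_imp_surj_on[OF \<phi>] by (auto dest: H.in_arcsD1 H.in_arcsD2)
    then obtain u v where "u \<in> pverts G" "v \<in> pverts G" "x = \<phi> u" "y = \<phi> v"
      by blast
    with arcs xy show "(x, y) \<in> map_prod \<phi> \<phi> ` parcs G"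
      by force
  qed
  then have "with_proj H = app_iso h (with_proj G)"
    using bij_betw_imp_surj_on[OF \<phi>] by (simp add: with_proj_def app_iso_def h_def)
  ultimately show ?thesis
    by (auto simp: digraph_iso_def)
qed

definition Some_arcs :: "'a pair_pre_digraph \<Rightarrow> 'a option rel" where
  "Some_arcs G = map_prod Some Some ` parcs G"

text \<open>
  The two families of arcs that join whole copies are one condition: the second index is the mirror
  image of the first. Distinctness of the end points excludes loops inside the first \<open>t\<close> copies, and
  excludes nothing else, since for even \<open>n - t\<close> no index above \<open>t\<close> is its own mirror image.
\<close>

lemma parcs_shuriken_iff:
  assumes "pair_bidirected_digraph G" and "t \<le> n" and "even (n - t)"
    and x: "x \<in> shuriken_base G" and y: "y \<in> shuriken_base G"
    and i: "i \<in> {1..n}" and j: "j \<in> {1..n}"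
  shows "((x, i), (y, j)) \<in> parcs (shuriken t n G) \<longleftrightarrow>
    (x, i) \<noteq> (y, j) \<and> ((x, y) \<in> Some_arcs G \<or> j = mirror t n i)"
proof -
  interpret G: pair_bidirected_digraph G by fact
  have sym: "(v, u) \<in> parcs G \<longleftrightarrow> (u, v) \<in> parcs G" for u v
    using G.pair_sym_arcs by (auto simp: symmetric_def sym_def)
  have irrefl: "(u, u) \<notin> parcs G" for u
    using G.pair_no_loops[of "(u, u)"] by auto
  have "((x, i), (y, j)) \<in> parcs (shuriken t n G) \<longleftrightarrow>
    (x, y) \<in> Some_arcs G \<or> (i = j \<and> i \<le> t \<and> x \<noteq> y) \<or>
    (t + 1 \<le> i \<and> i \<le> (n + t) div 2 \<and> j = n + t + 1 - i) \<or>
    (t + 1 \<le> j \<and> j \<le> (n + t) div 2 \<and> i = n + t + 1 - j)"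
    using x y i j sym by (auto simp: shuriken_def symcl_def Some_arcs_def)
  moreover have "(x, x) \<notin> Some_arcs G"
    using irrefl by (auto simp: Some_arcs_def)
  moreover obtain h where "n = t + 2 * h"
    using assms(2,3) by (metis evenE le_add_diff_inverse)
  ultimately show ?thesis
    using i j by (auto simp: mirror_def)
qed

text \<open>
  The map sends \<open>(e, u)\<close> to the vertex for \<open>e\<close> in the copy numbered by \<open>u\<close>, with the units numbered
  so that inversion becomes the mirror involution.
\<close>

theorem Cl2_iso_shuriken:
  fixes R (structure)
  assumes "ring R" and "finite (Units R)" and G: "pair_bidirected_digraph G"
    and \<psi>: "bij_betw \<psi> (idempotents R - {\<zero>}) (shuriken_base G)"
    and orth: "\<And>e f. \<lbrakk>e \<in> idempotents R - {\<zero>}; f \<in> idempotents R - {\<zero>}\<rbrakk> \<Longrightarrow>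
      e \<otimes> f = \<zero> \<and> f \<otimes> e = \<zero> \<longleftrightarrow> (\<psi> e, \<psi> f) \<in> Some_arcs G"
  shows "digraph_iso (with_proj (Cl2 R))
    (with_proj (shuriken (card (involutory_units R)) (card (Units R)) G))"
proof -
  interpret ring R by fact
  have inv_iff: "u \<otimes> v = \<one> \<and> v \<otimes> u = \<one> \<longleftrightarrow> v = inv u" if "u \<in> Units R" "v \<in> Units R" for u v
    using that by (metis Units_closed Units_l_inv Units_r_inv inv_unique')
  have fixed: "involutory_units R = {u \<in> Units R. inv u = u}"
    using inv_iff by (auto simp: involutory_units_def numeral_2_eq_2 Units_closed; metis)
  define t n where "t = card (involutory_units R)" and "n = card (Units R)"
  obtain \<phi> where \<phi>: "bij_betw \<phi> (Units R) {1..n}"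
    and mirror: "\<And>u. u \<in> Units R \<Longrightarrow> \<phi> (inv u) = mirror t n (\<phi> u)"
    and tn: "t \<le> n" "even (n - t)"
    using involution_enumeration[of "Units R" "m_inv R" t n] assms(2) fixed
    by (auto simp: t_def n_def)
  have "digraph_iso (with_proj (Cl2 R)) (with_proj (shuriken t n G))"
  proof (rule digraph_iso_with_projI)
    show "pair_wf_digraph (Cl2 R)" "pair_wf_digraph (shuriken t n G)"
      using pair_bidirected_Cl2 pair_bidirected_shuriken[OF G tn(1)]
      by (auto simp: pair_bidirected_digraph_def pair_sym_digraph_def)
    show "bij_betw (map_prod \<psi> \<phi>) (pverts (Cl2 R)) (pverts (shuriken t n G))"
      using bij_betw_map_prod[OF \<psi> \<phi>] by (simp add: Cl2_def Cl2_verts_def shuriken_def)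
  next
    fix p q assume "p \<in> pverts (Cl2 R)" "q \<in> pverts (Cl2 R)"
    then obtain e u f v where pq: "p = (e, u)" "q = (f, v)"
      and e: "e \<in> idempotents R - {\<zero>}" and f: "f \<in> idempotents R - {\<zero>}"
      and u: "u \<in> Units R" and v: "v \<in> Units R"
      by (auto simp: Cl2_def Cl2_verts_def)
    have "(p, q) \<in> parcs (Cl2 R) \<longleftrightarrow>
      (e, u) \<noteq> (f, v) \<and> ((\<psi> e, \<psi> f) \<in> Some_arcs G \<or> v = inv u)"
      using e f u v orth[OF e f] inv_iff[OF u v] by (auto simp: pq Cl2_def Cl2_verts_def)
    also have "\<dots> \<longleftrightarrow> (\<psi> e, \<phi> u) \<noteq> (\<psi> f, \<phi> v) \<and> ((\<psi> e, \<psi> f) \<in> Some_arcs G \<or> \<phi> v = mirror t n (\<phi> u))"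
      using bij_betw_imp_inj_on[OF \<psi>] bij_betw_imp_inj_on[OF \<phi>] e f u v mirror[OF u]
      by (metis Units_inv_Units inj_on_eq_iff prod.inject)
    also have "\<dots> \<longleftrightarrow> ((\<psi> e, \<phi> u), (\<psi> f, \<phi> v)) \<in> parcs (shuriken t n G)"
      using bij_betwE[OF \<psi>] bij_betwE[OF \<phi>] e f u v
      by (intro parcs_shuriken_iff[OF G tn, symmetric]) auto
    finally show "(p, q) \<in> parcs (Cl2 R) \<longleftrightarrow>
      (map_prod \<psi> \<phi> p, map_prod \<psi> \<phi> q) \<in> parcs (shuriken t n G)"
      by (simp add: pq)
  qed
  then show ?thesis
    by (simp add: t_def n_def)
qed

section \<open>Idempotents modulo a product of prime powers\<close>

text \<open>
  The consecutive integers \<open>e\<close> and \<open>e - 1\<close> are not both divisible by \<open>p\<close>, so the prime power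
  that divides their product divides one of them.
\<close>

lemma idempotent_mod_prime_power:
  fixes p e :: int
  assumes "prime p" and "p ^ k dvd e * e - e"
  shows "p ^ k dvd (if p dvd e then e else e - 1)"
proof -
  have *: "p ^ k dvd e * (e - 1)"
    using assms(2) by (simp add: algebra_simps)
  show ?thesis
  proof (cases "p dvd e")
    case True
    then have "\<not> p dvd e - 1"
      using assms(1) by (metis dvd_diff_right_iff not_prime_unit)
    then have "coprime (p ^ k) (e - 1)"
      using assms(1) by (simp add: prime_imp_coprime)
    with * True show ?thesis
      by (simp add: coprime_dvd_mult_left_iff)
  next
    case False
    then have "coprime (p ^ k) e"
      using assms(1) by (simp add: prime_imp_coprime)
    with * False show ?thesis
      by (simp add: coprime_dvd_mult_right_iff)
  qed
qed

context
  fixes P :: "nat set" and k :: "nat \<Rightarrow> nat" and N :: nat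
  assumes fin: "finite P" and P: "\<And>p. p \<in> P \<Longrightarrow> prime p" and k: "\<And>p. p \<in> P \<Longrightarrow> k p \<ge> 1"
    and N: "N = (\<Prod>p\<in>P. p ^ k p)"
begin

lemma coprime_prime_powers: "p \<in> P \<Longrightarrow> q \<in> P \<Longrightarrow> p \<noteq> q \<Longrightarrow> coprime (p ^ k p) (q ^ k q)"
  using P by (simp add: primes_coprime)

lemma N_dvd_iff: "int N dvd x \<longleftrightarrow> (\<forall>p\<in>P. int p ^ k p dvd x)"
proof
  assume "int N dvd x"
  moreover have "int p ^ k p dvd int N" if "p \<in> P" for p
    using dvd_prodI[OF fin that, of "\<lambda>p. int p ^ k p"] by (simp add: N)
  ultimately show "\<forall>p\<in>P. int p ^ k p dvd x"
    using dvd_trans by blast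
next
  assume "\<forall>p\<in>P. int p ^ k p dvd x"
  then have "[x = 0] (mod (\<Prod>p\<in>P. int p ^ k p))"
    using coprime_prime_powers
    by (intro cong_cong_prod_coprime) (auto simp: cong_0_iff simp flip: of_nat_power)
  then show "int N dvd x"
    by (simp add: N cong_0_iff)
qed

lemma N_pos: "N > 0"
  unfolding N by (intro prod_pos ballI) (simp add: P prime_gt_0_nat)

lemma idempotents_residue_ring:
  "idempotents (residue_ring (int N)) = {e. 0 \<le> e \<and> e < int N \<and> int N dvd e * e - e}"
  by (auto simp: idempotents_def residue_ring_def mod_eq_dvd_iff[symmetric])

text \<open>
  For idempotents \<open>e\<close>, the primes modulo which \<open>e\<close> is \<open>1\<close> and not \<open>0\<close>.
\<close>

definition support :: "int \<Rightarrow> nat set" where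
  "support e = {p \<in> P. \<not> int p dvd e}"

lemma prime_power_dvd_idempotent:
  assumes "e \<in> idempotents (residue_ring (int N))" and "p \<in> P"
  shows "int p ^ k p dvd (if p \<in> support e then e - 1 else e)"
  using idempotent_mod_prime_power[of "int p" "k p" e] assms P
  by (auto simp: idempotents_residue_ring N_dvd_iff support_def)

text \<open>
  An idempotent is congruent to the indicator function of its support modulo every prime power, so
  this is the Chinese remainder theorem for the residues \<open>0\<close> and \<open>1\<close>.
\<close>

lemma bij_betw_support: "bij_betw support (idempotents (residue_ring (int N))) (Pow P)"
proof (rule bij_betw_imageI)
  show "inj_on support (idempotents (residue_ring (int N)))"
  proof (rule inj_onI)
    fix e f assume e: "e \<in> idempotents (residue_ring (int N))"
      and f: "f \<in> idempotents (residue_ring (int N))" and ef: "support e = support f"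
    have "int p ^ k p dvd e - f" if "p \<in> P" for p
      using dvd_diff[OF prime_power_dvd_idempotent[OF e that] prime_power_dvd_idempotent[OF f that]]
      by (auto simp: ef split: if_splits)
    then have "int N dvd e - f"
      by (simp add: N_dvd_iff)
    then show "e = f"
      using e f by (auto simp: idempotents_residue_ring mod_eq_dvd_iff[symmetric])
  qed
  show "support ` idempotents (residue_ring (int N)) = Pow P"
  proof (intro equalityI subsetI)
    fix S assume "S \<in> Pow P"
    define \<chi> :: "nat \<Rightarrow> nat" where "\<chi> p = (if p \<in> S then 1 else 0)" for p
    have "\<exists>!x. x < (\<Prod>p\<in>P. p ^ k p) \<and> (\<forall>p\<in>P. [x = \<chi> p] (mod p ^ k p))"
    proof (intro chinese_remainder_unique_nat fin ballI impI)
      fix p assume "p \<in> P"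
      then show "p ^ k p \<noteq> 0"
        using prime_gt_0_nat[OF P] by simp
    qed (rule coprime_prime_powers)
    then obtain x where "x < N" and x: "\<And>p. p \<in> P \<Longrightarrow> [x = \<chi> p] (mod p ^ k p)"
      unfolding N by blast
    have "int p ^ k p dvd int x * int x - int x" if "p \<in> P" for p
    proof -
      have "[x * x = \<chi> p * \<chi> p] (mod p ^ k p)"
        using x[OF that] by (intro cong_mult)
      also have "\<chi> p * \<chi> p = \<chi> p"
        by (simp add: \<chi>_def)
      also have "[\<chi> p = x] (mod p ^ k p)"
        using x[OF that] by (rule cong_sym)
      finally show ?thesis
        by (simp add: cong_iff_dvd_diff flip: cong_int_iff)
    qed
    then have "int x \<in> idempotents (residue_ring (int N))"
      using \<open>x < N\<close> by (simp add: idempotents_residue_ring N_dvd_iff)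
    moreover have "p dvd x \<longleftrightarrow> p \<notin> S" if "p \<in> P" for p
    proof -
      have "p dvd p ^ k p"
        using k[OF that] by (simp add: dvd_power)
      then have "p dvd x \<longleftrightarrow> p dvd \<chi> p"
        using x[OF that] cong_dvd_modulus_nat cong_dvd_iff by blast
      then show ?thesis
        using P[OF that] by (auto simp: \<chi>_def)
    qed
    then have "support (int x) = S"
      using \<open>S \<in> Pow P\<close> by (auto simp: support_def)
    ultimately show "S \<in> support ` idempotents (residue_ring (int N))"
      by blast
  qed (auto simp: support_def)
qed

lemma bij_betw_support_nonzero:
  "bij_betw support (idempotents (residue_ring (int N)) - {\<zero>\<^bsub>residue_ring (int N)\<^esub>}) (Pow P - {{}})"
proof -
  have "0 \<in> idempotents (residue_ring (int N))" "support 0 = {}"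
    using N_pos by (auto simp: idempotents_residue_ring support_def)
  moreover have "\<zero>\<^bsub>residue_ring (int N)\<^esub> = 0"
    by (simp add: residue_ring_def)
  ultimately show ?thesis
    using bij_betw_DiffI[OF bij_betw_support, of "{0}" "{{}}"] by (simp add: bij_betw_def)
qed

text \<open>
  A prime divides \<open>ef\<close> if and only if it lies outside one of the supports, and then its full power
  already divides \<open>e\<close> or \<open>f\<close>.
\<close>

lemma orthogonal_iff_disjoint_support:
  assumes e: "e \<in> idempotents (residue_ring (int N))" and f: "f \<in> idempotents (residue_ring (int N))"
  shows "e \<otimes>\<^bsub>residue_ring (int N)\<^esub> f = \<zero>\<^bsub>residue_ring (int N)\<^esub> \<longleftrightarrow> support e \<inter> support f = {}"
proof -
  have "int p ^ k p dvd e * f \<longleftrightarrow> p \<notin> support e \<inter> support f" if p: "p \<in> P" for p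
  proof
    assume "int p ^ k p dvd e * f"
    moreover have "int p dvd int p ^ k p"
      using k[OF p] by (simp add: dvd_power)
    ultimately have "int p dvd e * f"
      using dvd_trans by blast
    then show "p \<notin> support e \<inter> support f"
      using P[OF p] by (auto simp: support_def prime_dvd_mult_iff)
  next
    assume "p \<notin> support e \<inter> support f"
    then show "int p ^ k p dvd e * f"
      using prime_power_dvd_idempotent[OF e p] prime_power_dvd_idempotent[OF f p]
      by (auto split: if_splits)
  qed
  then have "int N dvd e * f \<longleftrightarrow> support e \<inter> support f = {}"
    by (auto simp: N_dvd_iff support_def)
  then show ?thesis
    by (simp add: residue_ring_def dvd_eq_mod_eq_0)
qed

end

section \<open>Three primes\<close>

text \<open>
  The labelling by supports that realises \<open>G1\<close> as the disjointness graph on the nonempty proper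
  subsets of \<open>{p, q, r}\<close>, with the whole set for the added vertex \<open>z\<close>.
\<close>

definition G1_support :: "'a \<Rightarrow> 'a \<Rightarrow> 'a \<Rightarrow> G1_vertex option \<Rightarrow> 'a set" where
  "G1_support p q r x = (case x of None \<Rightarrow> {p, q, r}
    | Some va \<Rightarrow> {p} | Some vb \<Rightarrow> {q} | Some vc \<Rightarrow> {r}
    | Some vd \<Rightarrow> {q, r} | Some ve \<Rightarrow> {p, r} | Some vf \<Rightarrow> {p, q})"

lemma bij_betw_G1_support:
  assumes "p \<noteq> q" "p \<noteq> r" "q \<noteq> r"
  shows "bij_betw (G1_support p q r) (shuriken_base G1) (Pow {p, q, r} - {{}})"
  using assms
  by (intro bij_betw_imageI)
    (auto simp: inj_on_def G1_support_def shuriken_base_def G1_def Pow_insert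
      split: option.splits G1_vertex.splits)

lemma Some_arcs_G1_iff:
  assumes "p \<noteq> q" "p \<noteq> r" "q \<noteq> r"
  shows "(x, y) \<in> Some_arcs G1 \<longleftrightarrow> G1_support p q r x \<inter> G1_support p q r y = {}"
  using assms
  by (auto simp: G1_support_def Some_arcs_def G1_def symcl_def
      split: option.splits G1_vertex.splits)

theorem theorem5:
  fixes p1 p2 p3 n1 n2 n3 N :: nat
  assumes "prime p1" and "prime p2" and "prime p3"
    and "p1 \<noteq> p2" and "p1 \<noteq> p3" and "p2 \<noteq> p3"
    and "n1 \<ge> 1" and "n2 \<ge> 1" and "n3 \<ge> 1"
    and "N = p1 ^ n1 * p2 ^ n2 * p3 ^ n3"
  shows "digraph_iso (with_proj (Cl2 (residue_ring (int N))))
    (with_proj (shuriken (card (involutory_units (residue_ring (int N))))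
                         (card (Units (residue_ring (int N)))) G1))"
proof -
  define P where "P = {p1, p2, p3}"
  define k where "k p = (if p = p1 then n1 else if p = p2 then n2 else n3)" for p
  have fin: "finite P" and P: "\<And>p. p \<in> P \<Longrightarrow> prime p" and k: "\<And>p. p \<in> P \<Longrightarrow> k p \<ge> 1"
    and N: "N = (\<Prod>p\<in>P. p ^ k p)"
    using assms by (auto simp: P_def k_def)
  define R where "R = residue_ring (int N)"
  have "p1 dvd N" and "N \<noteq> 0"
    using assms by (auto simp: dvd_mult2)
  then have "N > 1"
    using prime_gt_1_nat[OF assms(1)] by (auto dest: dvd_imp_le)
  then interpret residues "int N" R
    by unfold_locales (simp_all add: R_def)
  define g where "g = G1_support p1 p2 p3"
  have g: "bij_betw g (shuriken_base G1) (Pow P - {{}})"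
    using bij_betw_G1_support assms by (simp add: g_def P_def)
  define \<psi> where "\<psi> = inv_into (shuriken_base G1) g \<circ> support P"
  have supp: "bij_betw (support P) (idempotents R - {\<zero>\<^bsub>R\<^esub>}) (Pow P - {{}})"
    using bij_betw_support_nonzero[OF fin P k N] by (simp add: R_def)
  have g\<psi>: "g (\<psi> e) = support P e" if "e \<in> idempotents R - {\<zero>\<^bsub>R\<^esub>}" for e
    using bij_betwE[OF supp] that bij_betw_inv_into_right[OF g] by (simp add: \<psi>_def)
  show ?thesis
    unfolding R_def[symmetric]
  proof (rule Cl2_iso_shuriken)
    show "ring R" "finite (Units R)" "pair_bidirected_digraph G1"
      by (simp_all add: ring_axioms pair_bidirected_G1)
    show "bij_betw \<psi> (idempotents R - {\<zero>\<^bsub>R\<^esub>}) (shuriken_base G1)"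
      unfolding \<psi>_def by (rule bij_betw_trans[OF supp bij_betw_inv_into[OF g]])
  next
    fix e f assume e: "e \<in> idempotents R - {\<zero>\<^bsub>R\<^esub>}" and f: "f \<in> idempotents R - {\<zero>\<^bsub>R\<^esub>}"
    have "e \<otimes>\<^bsub>R\<^esub> f = f \<otimes>\<^bsub>R\<^esub> e"
      using e f by (intro m_comm) (auto simp: idempotents_def)
    then show "e \<otimes>\<^bsub>R\<^esub> f = \<zero>\<^bsub>R\<^esub> \<and> f \<otimes>\<^bsub>R\<^esub> e = \<zero>\<^bsub>R\<^esub> \<longleftrightarrow> (\<psi> e, \<psi> f) \<in> Some_arcs G1"
      using orthogonal_iff_disjoint_support[OF fin P k N, of e f] e f g\<psi>
        Some_arcs_G1_iff[of p1 p2 p3 "\<psi> e" "\<psi> f"] assms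
      by (simp add: R_def g_def)
  qed
qed

end
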